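(* (1) For every $\mathcal{E}^->0$ there exists a family of graph search instances, each with total negative error $\mathcal{E}_1^-=\mathcal{E}^-$, such that every deterministic exploration algorithm incurs cost at least $\mathrm{OPT}+\mathcal{E}^-$ on some instance of the family. (2) For every integer $n>3$ and every value $\mathcal{E}_\infty^+\ge 0$ there exists a family of graph search instances on $n$ vertices, each with maximum positive error equal to $\mathcal{E}_\infty^+$, such that every deterministic exploration algorithm incurs cost at least $\mathrm{OPT}+\mathcal{E}_\infty^+(n-2)$ on some instance of the family.
   Context: Graph searching in the exploration setting: an instance consists of a finite graph $G=(V,E)$ (possibly directed) with positive edge weights and shortest-path distance $d_G$, a root $r\in V$, an unknown goal $g\in V$, and predictions $f:V\to\mathbb{R}$. For $S\subseteq V$, $\partial S$ is the set of vertices outside $S$ adjacent to some vertex of $S$. The agent starts at $r$ knowing only $r$, its neighbours, the edges between them and their predictions; at iteration $i$, having visited $V_{i-1}$ ($V_0=\{r\}$), it knows only the subgraph $G_i$ with vertex set $V_{i-1}\cup\partial V_{i-1}$ and all edges incident to $V_{i-1}$, plus the predictions there; it moves to some $v_i\in\partial V_{i-1}$ paying $d_{G_i}(v_{i-1},v_i)$, and recognizes $g$ only when visiting it. The cost is the total distance travelled until $g$ is visited; $\mathrm{OPT}=d_G(r,g)$. The total negative error is $\mathcal{E}_1^-=\sum_{v\in V}\max\{0,d_G(v,g)-f(v)\}$ and the maximum positive error is $\mathcal{E}_\infty^+=\max_{v\in V}\max\{0,f(v)-d_G(v,g)\}$. *)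

theory Defs
  imports "Graph_Theory.Graph_Theory"
begin

text \<open>
  Arcs are ordered pairs, so there are no parallel arcs. An undirected graph is a symmetric
  digraph whose weight function agrees on \<open>(u, v)\<close> and \<open>(v, u)\<close>.
\<close>

record 'v search_inst =
  inst_graph :: "'v pair_pre_digraph"
  inst_weight :: "('v \<times> 'v) weight_fun"
  inst_root :: 'v
  inst_goal :: 'v
  inst_pred :: "'v \<Rightarrow> real"

text \<open>
  Strong connectivity (connectivity in the undirected case) makes all distances
  \<open>d\<^sub>G(u, v)\<close> finite.
\<close>

definition search_instance :: "'v search_inst \<Rightarrow> bool" where
  "search_instance I \<longleftrightarrow>
     pair_digraph (inst_graph I) \<and>
     strongly_connected (with_proj (inst_graph I)) \<and>
     (\<forall>a \<in> parcs (inst_graph I). inst_weight I a > 0) \<and>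
     inst_root I \<in> pverts (inst_graph I) \<and>
     inst_goal I \<in> pverts (inst_graph I)"

text \<open>Infimum of the walk costs; \<open>\<infinity>\<close> if there is no walk.\<close>

definition graph_dist ::
  "'v pair_pre_digraph \<Rightarrow> ('v \<times> 'v) weight_fun \<Rightarrow> 'v \<Rightarrow> 'v \<Rightarrow> ereal" where
  "graph_dist G w u v = wf_digraph.\<mu> (with_proj G) w u v"

definition opt_cost :: "'v search_inst \<Rightarrow> ereal" where
  "opt_cost I = graph_dist (inst_graph I) (inst_weight I) (inst_root I) (inst_goal I)"

definition total_neg_error :: "'v search_inst \<Rightarrow> ereal" where
  "total_neg_error I =
     (\<Sum>v \<in> pverts (inst_graph I).
        max 0 (graph_dist (inst_graph I) (inst_weight I) v (inst_goal I) - ereal (inst_pred I v)))"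

definition max_pos_error :: "'v search_inst \<Rightarrow> ereal" where
  "max_pos_error I =
     Max ((\<lambda>v. max 0 (ereal (inst_pred I v)
                       - graph_dist (inst_graph I) (inst_weight I) v (inst_goal I)))
          ` pverts (inst_graph I))"

text \<open>Adjacency and incidence disregard the orientation of arcs.\<close>

definition boundary :: "'v pair_pre_digraph \<Rightarrow> 'v set \<Rightarrow> 'v set" where
  "boundary G S =
     {v \<in> pverts G - S. \<exists>u \<in> S. (u, v) \<in> parcs G \<or> (v, u) \<in> parcs G}"

definition explored :: "'v pair_pre_digraph \<Rightarrow> 'v set \<Rightarrow> 'v pair_pre_digraph" where
  "explored G S =
     \<lparr> pverts = S \<union> boundary G S, parcs = {a \<in> parcs G. fst a \<in> S \<or> snd a \<in> S} \<rparr>"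

text \<open>
  What the agent has been shown after visiting \<open>S\<close>. Weights and predictions are partial maps,
  so that nothing is disclosed outside the explored subgraph; the goal is not part of it.
\<close>

record 'v knowledge =
  known_graph :: "'v pair_pre_digraph"
  known_weight :: "'v \<times> 'v \<rightharpoonup> real"
  known_pred :: "'v \<rightharpoonup> real"

definition knowledge_of :: "'v search_inst \<Rightarrow> 'v set \<Rightarrow> 'v knowledge" where
  "knowledge_of I S =
     (let H = explored (inst_graph I) S in
      \<lparr> known_graph = H,
        known_weight = (\<lambda>a. Some (inst_weight I a)) |` parcs H,
        known_pred = (\<lambda>v. Some (inst_pred I v)) |` pverts H \<rparr>)"

text \<open>
  A deterministic strategy maps the sequence of vertices visited so far (all of them
  distinct from the goal) and the current knowledge to the next vertex. Earlier knowledge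
  can be recovered from these two arguments.
\<close>

type_synonym 'v strategy = "'v list \<Rightarrow> 'v knowledge \<Rightarrow> 'v"

text \<open>
  \<open>visits A I i\<close> is \<open>[v\<^sub>0, \<dots>, v\<^sub>i]\<close>. The recursion does not stop at the goal; moves made
  after reaching it are ignored below.
\<close>

primrec visits :: "'v strategy \<Rightarrow> 'v search_inst \<Rightarrow> nat \<Rightarrow> 'v list" where
  "visits A I 0 = [inst_root I]"
| "visits A I (Suc i) =
     visits A I i @ [A (visits A I i) (knowledge_of I (set (visits A I i)))]"

definition exploration_algorithm :: "'v strategy \<Rightarrow> bool" where
  "exploration_algorithm A \<longleftrightarrow>
     (\<forall>I i. search_instance I \<longrightarrow> inst_goal I \<notin> set (visits A I i) \<longrightarrow>
        A (visits A I i) (knowledge_of I (set (visits A I i)))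
          \<in> boundary (inst_graph I) (set (visits A I i)))"

definition step_cost :: "'v strategy \<Rightarrow> 'v search_inst \<Rightarrow> nat \<Rightarrow> ereal" where
  "step_cost A I i =
     graph_dist (explored (inst_graph I) (set (visits A I i))) (inst_weight I)
       (last (visits A I i)) (last (visits A I (Suc i)))"

definition search_cost :: "'v strategy \<Rightarrow> 'v search_inst \<Rightarrow> ereal" where
  "search_cost A I =
     (if \<exists>i. inst_goal I \<in> set (visits A I i)
      then \<Sum>i < (LEAST i. inst_goal I \<in> set (visits A I i)). step_cost A I i
      else \<infinity>)"

end

theory Submission
  imports Defs
begin

text \<open>
  Both families consist of stars with the root in the centre, equal edge weights \<open>w\<close> and the same
  prediction at every leaf; the members of a family differ only in which leaf is the goal. Since
  the goal is not part of the knowledge, an algorithm makes the same moves on all of them until it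
  hits the goal. With \<open>n\<close> vertices, the goal is placed at a leaf that the algorithm has not visited
  after \<open>n - 2\<close> moves, so that the cost is at least \<open>w + 2 w (n - 2)\<close>, where \<open>OPT = w\<close>.
  Leaf predictions \<open>0\<close> and \<open>n = 3\<close> give negative error \<open>2 w (n - 2) = 2 w\<close>, leaf predictions
  \<open>2 w\<close> give maximum positive error \<open>2 w\<close>.
\<close>

section \<open>Weighted stars and distances in their subgraphs\<close>

definition star :: "nat \<Rightarrow> nat pair_pre_digraph" where
  "star n = \<lparr> pverts = {..<n},
              parcs = {(u, v). u < n \<and> v < n \<and> u \<noteq> v \<and> (u = 0 \<or> v = 0)} \<rparr>"

definition star_dist :: "real \<Rightarrow> nat \<Rightarrow> nat \<Rightarrow> real" where
  "star_dist w u v = (if u = v then 0 else if u = 0 \<or> v = 0 then w else 2 * w)"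

text \<open>The centre has its own prediction \<open>p\<close> so that it contributes no error:
  \<open>p = w\<close> is exact in the negative family, and \<open>p = 0\<close> overestimates
  nothing in the positive one.\<close>

definition star_inst :: "nat \<Rightarrow> real \<Rightarrow> real \<Rightarrow> real \<Rightarrow> nat \<Rightarrow> nat search_inst" where
  "star_inst n w p q g =
     \<lparr> inst_graph = star n, inst_weight = (\<lambda>_. w), inst_root = 0, inst_goal = g,
       inst_pred = (\<lambda>v. if v = 0 then p else q) \<rparr>"

lemma star_simps [simp]:
  "pverts (star n) = {..<n}"
  "(u, v) \<in> parcs (star n) \<longleftrightarrow> u < n \<and> v < n \<and> u \<noteq> v \<and> (u = 0 \<or> v = 0)"
  by (auto simp: star_def)

lemma star_inst_simps [simp]:
  "inst_graph (star_inst n w p q g) = star n"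
  "inst_weight (star_inst n w p q g) = (\<lambda>_. w)"
  "inst_root (star_inst n w p q g) = 0"
  "inst_goal (star_inst n w p q g) = g"
  "inst_pred (star_inst n w p q g) = (\<lambda>v. if v = 0 then p else q)"
  by (simp_all add: star_inst_def)

lemma pair_digraph_star: "pair_digraph (star n)"
proof
  have "parcs (star n) \<subseteq> {..<n} \<times> {..<n}"
    by auto
  then show "finite (parcs (star n))"
    by (rule finite_subset) auto
qed auto

lemma pair_wf_digraph_explored:
  assumes "pair_wf_digraph G"
  shows "pair_wf_digraph (explored G S)"
proof -
  interpret pair_wf_digraph G by (fact assms)
  show ?thesis
    by unfold_locales
      (auto simp: explored_def boundary_def dest: in_arcsD1 in_arcsD2)
qed

text \<open>Step costs are measured in explored subgraphs, hence the general \<open>H\<close>. A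
  one-arc walk joins the centre and a leaf and costs \<open>w\<close>; a walk with at least two arcs
  costs at least \<open>2 * w\<close>, which bounds every value of \<open>star_dist\<close>.\<close>

lemma graph_dist_ge_star_dist:
  assumes "pair_wf_digraph H" and sub: "parcs H \<subseteq> parcs (star n)" and "w \<ge> 0"
  shows "ereal (star_dist w u v) \<le> graph_dist H (\<lambda>_. w) u v"
proof -
  interpret pair_wf_digraph H by (fact assms)
  have "star_dist w u v \<le> awalk_cost (\<lambda>_. w) p" if p: "awalk u p v" for p
  proof -
    have nonneg: "awalk_cost (\<lambda>_. w) p \<ge> 0" if "awalk u p v" for u p
      using pos_cost_pos_awalk_cost[OF that] \<open>w \<ge> 0\<close> by simp
    show ?thesis
    proof (cases p)
      case Nil
      then show ?thesis
        using p by (simp add: awalk_Nil_iff star_dist_def)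
    next
      case (Cons e p')
      then have e: "e \<in> parcs H" "u = fst e" and p': "awalk (snd e) p' v"
        using p by (auto simp: awalk_Cons_iff)
      show ?thesis
      proof (cases p')
        case Nil
        then have "(u, v) \<in> parcs (star n)"
          using e p' sub by (metis awalk_Nil_iff prod.collapse subsetD)
        then show ?thesis
          using Cons Nil by (auto simp: star_dist_def)
      next
        case (Cons e' p'')
        then have "awalk_cost (\<lambda>_. w) p'' \<ge> 0"
          using p' nonneg by (auto simp: awalk_Cons_iff)
        then show ?thesis
          using \<open>p = e # p'\<close> Cons \<open>w \<ge> 0\<close> by (simp add: star_dist_def)
      qed
    qed
  qed
  then show ?thesis
    unfolding graph_dist_def \<mu>_def by (auto intro!: INF_greatest)
qed

lemma awalk_star:
  assumes "u < n" "v < n"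
  obtains p where "pre_digraph.awalk (with_proj (star n)) u p v"
    "wf_digraph.awalk_cost (\<lambda>_. w) p = star_dist w u v"
proof -
  interpret pair_digraph "star n" by (rule pair_digraph_star)
  define p where "p = (if u = v then [] else if u = 0 \<or> v = 0 then [(u, v)] else [(u, 0), (0, v)])"
  have "awalk u p v"
    using assms by (auto simp: p_def awalk_simps)
  moreover have "awalk_cost (\<lambda>_. w) p = star_dist w u v"
    by (simp add: p_def star_dist_def)
  ultimately show thesis
    by (rule that)
qed

lemma graph_dist_star:
  assumes "w \<ge> 0" "u < n" "v < n"
  shows "graph_dist (star n) (\<lambda>_. w) u v = ereal (star_dist w u v)"
proof -
  interpret pair_digraph "star n" by (rule pair_digraph_star)
  from assms obtain p where p: "awalk u p v" and cost: "awalk_cost (\<lambda>_. w) p = star_dist w u v"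
    using awalk_star by blast
  have "graph_dist (star n) (\<lambda>_. w) u v \<le> ereal (star_dist w u v)"
    using min_cost_le_walk_cost[OF p, of "\<lambda>_. w"] cost by (simp add: graph_dist_def)
  moreover have "ereal (star_dist w u v) \<le> graph_dist (star n) (\<lambda>_. w) u v"
    by (rule graph_dist_ge_star_dist[OF pair_wf_digraph subset_refl \<open>w \<ge> 0\<close>])
  ultimately show ?thesis
    by (rule antisym)
qed

section \<open>Validity, optimal cost and prediction errors of star instances\<close>

lemma search_instance_star_inst:
  assumes "w > 0" "g < n"
  shows "search_instance (star_inst n w p q g)"
proof -
  interpret pair_digraph "star n" by (rule pair_digraph_star)
  have "strongly_connected (with_proj (star n))"
  proof (rule strongly_connectedI)
    show "verts (with_proj (star n)) \<noteq> {}"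
      using assms by auto
    fix u v assume "u \<in> verts (with_proj (star n))" "v \<in> verts (with_proj (star n))"
    then show "u \<rightarrow>\<^sup>*\<^bsub>with_proj (star n)\<^esub> v"
      using awalk_star[of u n v w] reachable_awalkI[of u _ v] by auto
  qed
  then show ?thesis
    using assms pair_digraph_star by (auto simp: search_instance_def)
qed

lemma opt_cost_star_inst:
  assumes "w \<ge> 0" "0 < g" "g < n"
  shows "opt_cost (star_inst n w p q g) = ereal w"
  using assms by (simp add: opt_cost_def graph_dist_star star_dist_def)

text \<open>Only the leaf other than the goal contributes: its distance \<open>2 * w\<close> is
  predicted as \<open>0\<close>, while the predictions at the centre and at the goal are
  exact.\<close>

lemma total_neg_error_star_inst:
  assumes "w \<ge> 0" "g \<in> {1, 2}"
  shows "total_neg_error (star_inst 3 w w 0 g) = ereal (2 * w)"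
proof -
  have "total_neg_error (star_inst 3 w w 0 g)
      = (\<Sum>v<3. ereal (max 0 (star_dist w v g - (if v = 0 then w else 0))))"
    unfolding total_neg_error_def using assms
    by (intro sum.cong) (auto simp: graph_dist_star max_def)
  also have "\<dots> = ereal (2 * w)"
    using assms by (auto simp: star_dist_def eval_nat_numeral)
  finally show ?thesis .
qed

text \<open>The maximum is attained at the goal, whose distance is \<open>0\<close>. Elsewhere
  nothing is overestimated: \<open>q\<close> is at most \<open>2 * w\<close> at the other leaves,
  and \<open>0\<close> is at most \<open>w\<close> at the centre.\<close>

lemma max_pos_error_star_inst:
  assumes "w \<ge> 0" "0 < g" "g < n" "0 \<le> q" "q \<le> 2 * w"
  shows "max_pos_error (star_inst n w 0 q g) = ereal q"
  unfolding max_pos_error_def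
proof (rule Max_eqI)
  show "ereal q \<in> (\<lambda>v. max 0 (ereal (inst_pred (star_inst n w 0 q g) v)
      - graph_dist (inst_graph (star_inst n w 0 q g)) (inst_weight (star_inst n w 0 q g)) v
          (inst_goal (star_inst n w 0 q g)))) ` pverts (inst_graph (star_inst n w 0 q g))"
    using assms by (intro image_eqI[of _ _ g]) (auto simp: graph_dist_star star_dist_def max_def)
qed (use assms in \<open>auto simp: graph_dist_star star_dist_def\<close>)

section \<open>Moves of an algorithm on star instances and their costs\<close>

lemma visits_star_inst_goal_irrelevant:
  "visits A (star_inst n w p q g) i = visits A (star_inst n w p q g') i"
  \<comment> \<open>\<open>knowledge_of\<close> never reads the goal and \<open>visits\<close> does
    not stop there, so the equality persists even after a goal has been hit.\<close>
  by (induction i) (simp_all add: knowledge_of_def)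

lemma length_visits: "length (visits A I i) = Suc i"
  by (induction i) auto

lemma set_visits_mono: "i \<le> j \<Longrightarrow> set (visits A I i) \<subseteq> set (visits A I j)"
  by (induction rule: dec_induct) auto

lemma root_in_visits: "inst_root I \<in> set (visits A I i)"
  by (induction i) auto

lemma last_visits_in_visits: "last (visits A I i) \<in> set (visits A I i)"
  by (intro last_in_set) (auto simp flip: length_0_conv simp: length_visits)

lemma next_visit_in_boundary:
  assumes "exploration_algorithm A" "search_instance I" "inst_goal I \<notin> set (visits A I i)"
  shows "last (visits A I (Suc i)) \<in> boundary (inst_graph I) (set (visits A I i))"
  using assms by (simp add: exploration_algorithm_def)

text \<open>The root is visited from the start, so every move ends at a fresh leaf. Move
  \<open>0\<close> starts at the centre; each later one starts at another leaf and has to pass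
  through the centre.\<close>

lemma step_cost_star_inst_ge:
  defines "c \<equiv> \<lambda>w i. if i = 0 then w else 2 * w"
  assumes A: "exploration_algorithm A" and "w > 0" "g < n"
    and unseen: "g \<notin> set (visits A (star_inst n w p q g) i)"
  shows "ereal (c w i) \<le> step_cost A (star_inst n w p q g) i"
proof -
  let ?I = "star_inst n w p q g"
  let ?u = "last (visits A ?I i)" and ?v = "last (visits A ?I (Suc i))"
  \<comment> \<open>Needed for two moves: the current one, \<open>j = i\<close>, and the previous
    one, which shows that \<open>?u\<close> is a leaf.\<close>
  have new: "last (visits A ?I (Suc j)) \<notin> set (visits A ?I j)" if "j \<le> i" for j
  proof -
    have "g \<notin> set (visits A ?I j)"
      using unseen set_visits_mono[OF that, of A ?I] by blast
    then show ?thesis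
      using next_visit_in_boundary[OF A search_instance_star_inst[OF \<open>w > 0\<close> \<open>g < n\<close>], of p q j]
      by (simp add: boundary_def)
  qed
  have leaf: "last (visits A ?I (Suc j)) \<noteq> 0" if "j \<le> i" for j
    using new[OF that] root_in_visits[of ?I A j] by (metis star_inst_simps(3))
  have "?v \<noteq> ?u"
    using new[OF order_refl] last_visits_in_visits[of A ?I i] by (auto simp del: visits.simps)
  moreover have "?v \<noteq> 0"
    using leaf[OF order_refl] .
  moreover have "?u \<noteq> 0" if nonzero: "i \<noteq> 0"
  proof -
    obtain j where "i = Suc j"
      using not0_implies_Suc[OF nonzero] by blast
    then show ?thesis
      using leaf[of j] by (simp del: visits.simps)
  qed
  ultimately have "c w i \<le> star_dist w ?u ?v"
    using \<open>w > 0\<close> by (auto simp: c_def star_dist_def)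
  also have "ereal (star_dist w ?u ?v) \<le> step_cost A ?I i"
  proof -
    interpret pair_digraph "star n" by (rule pair_digraph_star)
    show ?thesis
      unfolding step_cost_def star_inst_simps
      by (rule graph_dist_ge_star_dist[OF pair_wf_digraph_explored[OF pair_wf_digraph]])
        (use \<open>w > 0\<close> in \<open>auto simp: explored_def\<close>)
  qed
  finally show ?thesis
    by simp
qed

lemma search_cost_star_inst_ge:
  assumes A: "exploration_algorithm A" and "w > 0" "g < n"
    and unseen: "g \<notin> set (visits A (star_inst n w p q g) m)"
  shows "ereal (w + 2 * w * real m) \<le> search_cost A (star_inst n w p q g)"
proof (cases "\<exists>i. g \<in> set (visits A (star_inst n w p q g) i)")
  case False
  then show ?thesis
    by (simp add: search_cost_def)
next
  case True
  let ?I = "star_inst n w p q g"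
  define k where "k = (LEAST i. g \<in> set (visits A ?I i))"
  have "g \<in> set (visits A ?I k)"
    unfolding k_def using True by (rule LeastI_ex)
  then have "m < k"
    using unseen set_visits_mono[of k m A ?I] by (meson in_mono not_le)
  then obtain l where k: "k = Suc l" and "m \<le> l"
    by (metis less_Suc_eq_le not0_implies_Suc not_less_zero)
  have "w + 2 * w * real m \<le> w + 2 * w * real l"
    using \<open>w > 0\<close> \<open>m \<le> l\<close> by simp
  \<comment> \<open>The first of the \<open>k = Suc l\<close> moves contributes \<open>w\<close>,
    the other \<open>l\<close> contribute \<open>2 * w\<close> each.\<close>
  also have "\<dots> = (\<Sum>i<k. if i = 0 then w else 2 * w)"
    unfolding k by (subst sum.lessThan_Suc_shift) simp
  also have "ereal \<dots> = (\<Sum>i<k. ereal (if i = 0 then w else 2 * w))"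
    by simp
  also have "\<dots> \<le> (\<Sum>i<k. step_cost A ?I i)"
  proof (rule sum_mono)
    fix i assume "i \<in> {..<k}"
    \<comment> \<open>Minimality of \<open>k\<close>: the goal is still unseen before each counted
      move, so the bound on single steps applies.\<close>
    then have "g \<notin> set (visits A ?I i)"
      unfolding k_def using not_less_Least by blast
    then show "ereal (if i = 0 then w else 2 * w) \<le> step_cost A ?I i"
      using step_cost_star_inst_ge[OF A \<open>w > 0\<close> \<open>g < n\<close>] by blast
  qed
  also have "\<dots> = search_cost A ?I"
    using True by (simp add: search_cost_def k_def)
  finally show ?thesis
    by simp
qed

lemma star_inst_adversary:
  assumes A: "exploration_algorithm A" and "w > 0" "n \<ge> 2"
  shows "\<exists>g \<in> {1..<n}. search_cost A (star_inst n w p q g)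
           \<ge> opt_cost (star_inst n w p q g) + ereal (2 * w * (real n - 2))"
proof -
  \<comment> \<open>The goal \<open>0\<close> is a placeholder, since the actual goal is chosen only
    after the moves are known. After \<open>n - 2\<close> moves the list has \<open>n - 1\<close>
    entries, so some vertex is missing from \<open>V\<close>.\<close>
  define V where "V = set (visits A (star_inst n w p q 0) (n - 2))"
  have "card V \<le> n - 1"
    unfolding V_def using card_length[of "visits A (star_inst n w p q 0) (n - 2)"] \<open>n \<ge> 2\<close>
    by (simp add: length_visits)
  then have "\<not> {..<n} \<subseteq> V"
    using card_mono[of V "{..<n}"] \<open>n \<ge> 2\<close> by (auto simp: V_def)
  then obtain g where "g < n" "g \<notin> V"
    by auto
  moreover have "0 \<in> V"
    unfolding V_def using root_in_visits[of "star_inst n w p q 0"] by simp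
  ultimately have g: "g \<in> {1..<n}"
    by (cases "g = 0") auto
  have "g \<notin> set (visits A (star_inst n w p q g) (n - 2))"
    using \<open>g \<notin> V\<close> visits_star_inst_goal_irrelevant unfolding V_def by metis
  then have "ereal (w + 2 * w * real (n - 2)) \<le> search_cost A (star_inst n w p q g)"
    using search_cost_star_inst_ge[OF A \<open>w > 0\<close> \<open>g < n\<close>] by blast
  then show ?thesis
    using g \<open>w > 0\<close> \<open>n \<ge> 2\<close> by (intro bexI[of _ g]) (simp_all add: opt_cost_star_inst of_nat_diff)
qed

theorem theorem5:
  shows "(\<forall>E :: real. E > 0 \<longrightarrow>
           (\<exists>F :: nat search_inst set.
              (\<forall>I \<in> F. search_instance I \<and> total_neg_error I = ereal E) \<and>
              (\<forall>A. exploration_algorithm A \<longrightarrow>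
                 (\<exists>I \<in> F. search_cost A I \<ge> opt_cost I + ereal E))))
       \<and> (\<forall>(n :: nat) (E :: real). n > 3 \<longrightarrow> E \<ge> 0 \<longrightarrow>
           (\<exists>F :: nat search_inst set.
              (\<forall>I \<in> F. search_instance I \<and> card (pverts (inst_graph I)) = n \<and>
                 max_pos_error I = ereal E) \<and>
              (\<forall>A. exploration_algorithm A \<longrightarrow>
                 (\<exists>I \<in> F. search_cost A I \<ge> opt_cost I + ereal (E * (real n - 2))))))"
proof (intro conjI allI impI)
  fix E :: real assume "E > 0"
  \<comment> \<open>With \<open>w = E / 2\<close> and three vertices, both the negative error
    \<open>2 * w\<close> and the excess \<open>2 * w * (n - 2)\<close> equal
    \<open>E\<close>.\<close>
  let ?F = "star_inst 3 (E / 2) (E / 2) 0 ` {1..<3}"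
  show "\<exists>F :: nat search_inst set.
      (\<forall>I \<in> F. search_instance I \<and> total_neg_error I = ereal E) \<and>
      (\<forall>A. exploration_algorithm A \<longrightarrow> (\<exists>I \<in> F. search_cost A I \<ge> opt_cost I + ereal E))"
  proof (rule exI[of _ ?F], intro conjI ballI allI impI)
    fix I assume "I \<in> ?F"
    then obtain g where I: "I = star_inst 3 (E / 2) (E / 2) 0 g" and "g \<in> {1..<3}"
      by blast
    then have g: "g \<in> {1, 2}" "g < 3"
      by auto
    show "search_instance I"
      using g \<open>E > 0\<close> by (simp add: I search_instance_star_inst)
    show "total_neg_error I = ereal E"
      using total_neg_error_star_inst[of "E / 2" g] g \<open>E > 0\<close> by (simp add: I)
  next
    fix A :: "nat strategy" assume "exploration_algorithm A"
    from star_inst_adversary[OF this, of "E / 2" 3 "E / 2" 0] \<open>E > 0\<close>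
    show "\<exists>I \<in> ?F. search_cost A I \<ge> opt_cost I + ereal E"
      by simp
  qed
next
  fix n :: nat and E :: real assume "n > 3" "E \<ge> 0"
  \<comment> \<open>Weights must be positive also if \<open>E = 0\<close>.\<close>
  define w where "w = (if E = 0 then 1 else E / 2)"
  have w: "w > 0" "E \<le> 2 * w"
    using \<open>E \<ge> 0\<close> by (auto simp: w_def)
  let ?F = "star_inst n w 0 E ` {1..<n}"
  show "\<exists>F :: nat search_inst set.
      (\<forall>I \<in> F. search_instance I \<and> card (pverts (inst_graph I)) = n \<and> max_pos_error I = ereal E) \<and>
      (\<forall>A. exploration_algorithm A \<longrightarrow>
         (\<exists>I \<in> F. search_cost A I \<ge> opt_cost I + ereal (E * (real n - 2))))"
  proof (rule exI[of _ ?F], intro conjI ballI allI impI)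
    fix I assume "I \<in> ?F"
    then obtain g where I: "I = star_inst n w 0 E g" and g: "0 < g" "g < n"
      by auto
    show "search_instance I"
      using g w by (simp add: I search_instance_star_inst)
    show "card (pverts (inst_graph I)) = n"
      by (simp add: I)
    show "max_pos_error I = ereal E"
      using g w \<open>E \<ge> 0\<close> by (simp add: I max_pos_error_star_inst)
  next
    fix A :: "nat strategy" assume "exploration_algorithm A"
    then obtain g where g: "g \<in> {1..<n}" and
      cost: "opt_cost (star_inst n w 0 E g) + ereal (2 * w * (real n - 2))
        \<le> search_cost A (star_inst n w 0 E g)"
      using star_inst_adversary[of A w n 0 E] w \<open>n > 3\<close> by auto
    \<comment> \<open>Equality for positive \<open>E\<close>; for \<open>E = 0\<close> the weight
      \<open>1\<close> gives more than the required excess \<open>0\<close>.\<close>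
    have "E * (real n - 2) \<le> 2 * w * (real n - 2)"
      using w \<open>n > 3\<close> by (intro mult_right_mono) auto
    then have "opt_cost (star_inst n w 0 E g) + ereal (E * (real n - 2))
        \<le> search_cost A (star_inst n w 0 E g)"
      by (intro order_trans[OF add_left_mono cost]) simp
    then show "\<exists>I \<in> ?F. search_cost A I \<ge> opt_cost I + ereal (E * (real n - 2))"
      using g by blast
  qed
qed

end
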